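(* $\mathrm{bal}_3(n,P_6)=\left(\tfrac{1}{2}+o(1)\right)n$ as $n\to\infty$.
   Context: $P_m$ denotes the path with $m$ edges. A $3$-edge-colored graph $G$ is balanced if each of the $3$ colors appears on either $\lfloor e(G)/3\rfloor$ or $\lceil e(G)/3\rceil$ edges (so a balanced $P_6$ has exactly $2$ edges of each color). $\mathrm{bal}_3(n,G)$ is the minimum integer $m$ (if it exists) such that every $3$-edge-coloring of $K_n$ with more than $m$ edges in each of the $3$ colors contains a balanced copy of $G$; if no such $m$ exists it is $\infty$. *)

theory Defs
  imports Complex_Main "HOL-Library.Extended_Nat" "HOL-Library.Extended_Real"
begin

text \<open>A graph is a pair of a vertex set and an edge set, the edges being two-element sets of
  vertices.\<close>

type_synonym 'a graph = "'a set \<times> 'a set set"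

abbreviation verts :: "'a graph \<Rightarrow> 'a set" where "verts \<equiv> fst"
abbreviation edges :: "'a graph \<Rightarrow> 'a set set" where "edges \<equiv> snd"

definition simple_graph :: "'a graph \<Rightarrow> bool" where
  "simple_graph G \<longleftrightarrow> finite (verts G) \<and> (\<forall>e\<in>edges G. e \<subseteq> verts G \<and> card e = 2)"

definition complete_graph :: "nat \<Rightarrow> nat graph" where
  "complete_graph n = ({..<n}, {e. e \<subseteq> {..<n} \<and> card e = 2})"

text \<open>Paths are indexed by the number of edges, so this one has \<open>m + 1\<close> vertices.\<close>

definition path_graph :: "nat \<Rightarrow> nat graph" where
  "path_graph m = ({..m}, {{i, Suc i} | i. i < m})"

definition subgraph :: "'a graph \<Rightarrow> 'a graph \<Rightarrow> bool" where
  "subgraph H G \<longleftrightarrow> simple_graph H \<and> verts H \<subseteq> verts G \<and> edges H \<subseteq> edges G"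

definition graph_isomorphic :: "'a graph \<Rightarrow> 'b graph \<Rightarrow> bool" where
  "graph_isomorphic G H \<longleftrightarrow>
     (\<exists>f. bij_betw f (verts G) (verts H) \<and> edges H = (\<lambda>e. f ` e) ` edges G)"

definition edge_coloring :: "nat \<Rightarrow> 'a graph \<Rightarrow> ('a set \<Rightarrow> nat) \<Rightarrow> bool" where
  "edge_coloring k G c \<longleftrightarrow> (\<forall>e\<in>edges G. c e < k)"

definition color_class :: "'a graph \<Rightarrow> ('a set \<Rightarrow> nat) \<Rightarrow> nat \<Rightarrow> 'a set set" where
  "color_class G c i = {e \<in> edges G. c e = i}"

definition balanced :: "nat \<Rightarrow> 'a graph \<Rightarrow> ('a set \<Rightarrow> nat) \<Rightarrow> bool" where
  "balanced k G c \<longleftrightarrow>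
     (\<forall>i<k. int (card (color_class G c i)) = \<lfloor>real (card (edges G)) / real k\<rfloor> \<or>
            int (card (color_class G c i)) = \<lceil>real (card (edges G)) / real k\<rceil>)"

definition contains_balanced_copy ::
    "nat \<Rightarrow> 'b graph \<Rightarrow> ('b set \<Rightarrow> nat) \<Rightarrow> 'a graph \<Rightarrow> bool" where
  "contains_balanced_copy k K c G \<longleftrightarrow>
     (\<exists>H. subgraph H K \<and> graph_isomorphic G H \<and> balanced k H c)"

text \<open>The infimum over \<^typ>\<open>enat\<close> is the minimum of a nonempty set, and \<open>\<infinity>\<close> for the empty set.
  Ranging over natural \<open>m\<close> loses nothing for \<open>k \<ge> 2\<close> and \<open>G\<close> with at least \<open>k\<close> edges: a negative
  \<open>m\<close> would admit the colorings using a single color, which have no balanced copy of \<open>G\<close>.\<close>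

definition bal :: "nat \<Rightarrow> nat \<Rightarrow> 'a graph \<Rightarrow> enat" where
  "bal k n G =
     Inf {enat m | m. \<forall>c. edge_coloring k (complete_graph n) c \<and>
                         (\<forall>i<k. card (color_class (complete_graph n) c i) > m) \<longrightarrow>
                       contains_balanced_copy k (complete_graph n) c G}"

end

theory Submission
  imports Defs "HOL-Library.Ramsey" "HOL-Library.Multiset"
begin

text \<open>
  Lower bound: color the star at one vertex half red and half blue and everything else green.
  A path meets the star in at most two edges, so no \<open>P\<^sub>6\<close> has two red and two blue edges.

  Upper bound \<open>n / 2 + O(1)\<close>: by Ramsey's theorem there is a large monochromatic, say green, clique
  \<open>K\<close>. Call a vertex red (blue) if it sends many red (blue) edges to \<open>K\<close>. A red and another blue
  vertex give a balanced path through \<open>K\<close>. If there are two red vertices and no blue one, then, as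
  blue has more than \<open>n / 2\<close> edges, some blue 2-edge path avoids one of them, and it closes up to a
  balanced path through \<open>K\<close>. Otherwise all vertices but one are joined to almost all of \<open>K\<close> by green
  edges, so a red and a blue 2-edge path that are disjoint can be linked through \<open>K\<close>. If no such
  disjoint pair exists, there is a vertex \<open>z\<close> off which red and blue are both matchings. Since red and
  blue have more than \<open>n\<close> edges together, one of these matchings is large, and
  two of its edges together with two edges of the other color at \<open>z\<close> are linked by green edges.
\<close>

section \<open>Colored paths, color degrees and matchings\<close>

lemma ex_notin_list:
  assumes "length xs < card A"
  obtains x where "x \<in> A" "x \<notin> set xs"
proof -
  have "\<not> A \<subseteq> set xs"
    using assms card_length[of xs] card_mono[of "set xs" A] by auto
  then show ?thesis using that by blast
qed

text \<open>Recording the colors as a multiset forgets their order along the path, so each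
  construction may place them as it likes, and exchanging two colors keeps the balanced
  target.\<close>

definition has_path6 :: "'v set \<Rightarrow> ('v set \<Rightarrow> 'k) \<Rightarrow> 'k multiset \<Rightarrow> bool" where
  "has_path6 V c M \<longleftrightarrow> (\<exists>p q r s t u v. distinct [p, q, r, s, t, u, v] \<and> {p, q, r, s, t, u, v} \<subseteq> V \<and>
     {#c {p, q}, c {q, r}, c {r, s}, c {s, t}, c {t, u}, c {u, v}#} = M)"

lemma has_path6I:
  assumes "distinct [p, q, r, s, t, u, v]" "{p, q, r, s, t, u, v} \<subseteq> V"
    "{#c {p, q}, c {q, r}, c {r, s}, c {s, t}, c {t, u}, c {u, v}#} = M"
  shows "has_path6 V c M"
  using assms unfolding has_path6_def by blast

text \<open>The colors are abstract so that \<open>a\<close> and \<open>b\<close> can be exchanged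
  and \<open>g\<close> can be the color of whichever monochromatic clique is found.\<close>

locale three_colored =
  fixes V :: "'v set" and c :: "'v set \<Rightarrow> 'k" and a b g :: 'k
  assumes finite_V: "finite V"
    and distinct_colors: "distinct [a, b, g]"
    and color_cases: "\<lbrakk>x \<in> V; y \<in> V; x \<noteq> y\<rbrakk> \<Longrightarrow> c {x, y} = a \<or> c {x, y} = b \<or> c {x, y} = g"
begin

lemma swapped: "three_colored V c b a g"
  using finite_V distinct_colors color_cases by unfold_locales auto

text \<open>Used with \<open>U = V\<close> for color degrees and with \<open>U = K\<close> for
  attachment to the clique.\<close>

definition nb :: "'v set \<Rightarrow> 'k \<Rightarrow> 'v \<Rightarrow> 'v set" where
  "nb U i v = {u \<in> U - {v}. c {v, u} = i}"

definition path2 :: "'k \<Rightarrow> 'v \<Rightarrow> 'v \<Rightarrow> 'v \<Rightarrow> bool" where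
  "path2 i u v w \<longleftrightarrow> {u, v, w} \<subseteq> V \<and> distinct [u, v, w] \<and> c {u, v} = i \<and> c {v, w} = i"

definition color_edges :: "'k \<Rightarrow> 'v set set" where
  "color_edges i = {e. e \<subseteq> V \<and> card e = 2 \<and> c e = i}"

lemma nb_iff: "u \<in> nb U i v \<longleftrightarrow> u \<in> U \<and> u \<noteq> v \<and> c {v, u} = i \<and> c {u, v} = i"
  by (auto simp: nb_def insert_commute)

lemma path2_commute: "path2 i u v w \<longleftrightarrow> path2 i w v u"
  by (auto simp: path2_def insert_commute)

lemma finite_color_edges: "finite (color_edges i)"
  unfolding color_edges_def using finite_V by simp

lemma finite_nb: "U \<subseteq> V \<Longrightarrow> finite (nb U i v)"
  unfolding nb_def using finite_V finite_subset by fastforce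

lemma card_nb_add:
  assumes "U \<subseteq> V" "v \<in> V"
  shows "card (nb U a v) + card (nb U b v) + card (nb U g v) = card (U - {v})"
proof -
  have "U - {v} = nb U a v \<union> nb U b v \<union> nb U g v"
    using color_cases[of v] assms by (auto simp: nb_def)
  then show ?thesis
    using finite_nb[OF assms(1)] distinct_colors
    by (auto simp: nb_iff card_Un_disjoint disjoint_iff)
qed

text \<open>Two edges of one color sharing a vertex form a 2-edge path, so off \<open>S\<close> the
  color is a matching.\<close>

lemma color_edges_disjoint:
  assumes free: "\<nexists>u v w. path2 i u v w \<and> {u, v, w} \<inter> S = {}"
    and e: "e \<in> color_edges i" "e' \<in> color_edges i" "e \<inter> S = {}" "e' \<inter> S = {}" "e \<noteq> e'"
  shows "e \<inter> e' = {}"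
proof (rule ccontr)
  assume "e \<inter> e' \<noteq> {}"
  then obtain v where v: "v \<in> e" "v \<in> e'" by blast
  obtain u where u: "e = {u, v}" "u \<noteq> v"
    using e(1) v(1) by (auto simp: color_edges_def card_2_iff)
  obtain w where w: "e' = {v, w}" "w \<noteq> v"
    using e(2) v(2) by (auto simp: color_edges_def card_2_iff)
  have "path2 i u v w" "{u, v, w} \<inter> S = {}"
    using e u w by (auto simp: path2_def color_edges_def insert_commute)
  then show False using free by blast
qed

text \<open>The edges off \<open>S\<close> form a matching, and each remaining edge is counted in
  the degree of some vertex of \<open>S\<close>. The matching bound \<open>card V / 2\<close> is the
  source of the constant 1/2 in the upper bound.\<close>

lemma card_color_edges_le:
  assumes S: "S \<subseteq> V" and free: "\<nexists>u v w. path2 i u v w \<and> {u, v, w} \<inter> S = {}"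
  shows "2 * card (color_edges i) \<le> card V + 2 * (\<Sum>s\<in>S. card (nb V i s))"
proof -
  have fS: "finite S" using S finite_V finite_subset by blast
  define M where "M = {e \<in> color_edges i. e \<inter> S = {}}"
  have fM: "finite M" using finite_color_edges by (auto simp: M_def)
  have disj: "e \<inter> e' = {}" if "e \<in> M" "e' \<in> M" "e \<noteq> e'" for e e'
    using color_edges_disjoint[OF free, of e e'] that by (simp add: M_def)
  have "2 * card M = (\<Sum>e\<in>M. card e)"
    by (simp add: M_def color_edges_def)
  also have "\<dots> = card (\<Union>M)"
  proof (rule card_Union_disjoint[symmetric])
    show "pairwise disjnt M" using disj by (simp add: pairwise_def disjnt_def)
    show "finite e" if "e \<in> M" for e
      using that by (intro card_ge_0_finite) (simp add: M_def color_edges_def)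
  qed
  also have "\<dots> \<le> card V"
    by (rule card_mono[OF finite_V]) (auto simp: M_def color_edges_def)
  finally have M: "2 * card M \<le> card V" .
  have "color_edges i \<subseteq> M \<union> (\<Union>s\<in>S. (\<lambda>u. {s, u}) ` nb V i s)"
  proof
    fix e assume e: "e \<in> color_edges i"
    show "e \<in> M \<union> (\<Union>s\<in>S. (\<lambda>u. {s, u}) ` nb V i s)"
    proof (cases "e \<inter> S = {}")
      case True then show ?thesis using e by (simp add: M_def)
    next
      case False
      then obtain s where s: "s \<in> e" "s \<in> S" by blast
      then obtain u where "e = {s, u}" "u \<noteq> s"
        using e by (auto simp: color_edges_def card_2_iff)
      then have "u \<in> nb V i s" using e by (auto simp: color_edges_def nb_def)
      then show ?thesis using s \<open>e = {s, u}\<close> by blast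
    qed
  qed
  then have "card (color_edges i) \<le> card (M \<union> (\<Union>s\<in>S. (\<lambda>u. {s, u}) ` nb V i s))"
    by (rule card_mono[rotated]) (use fM fS finite_nb in auto)
  also have "\<dots> \<le> card M + card (\<Union>s\<in>S. (\<lambda>u. {s, u}) ` nb V i s)"
    by (rule card_Un_le)
  also have "card (\<Union>s\<in>S. (\<lambda>u. {s, u}) ` nb V i s) \<le> (\<Sum>s\<in>S. card ((\<lambda>u. {s, u}) ` nb V i s))"
    by (rule card_UN_le[OF fS])
  also have "\<dots> \<le> (\<Sum>s\<in>S. card (nb V i s))"
    by (intro sum_mono card_image_le finite_nb) simp
  finally show ?thesis using M by simp
qed

text \<open>Ten serves as "many" throughout: it exceeds the number of vertices that any later choice
  of a neighbor has to avoid.\<close>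

lemma disjoint_path2_of_star:
  assumes "z \<in> V" "card (nb V i z) \<ge> 10" "z \<notin> set xs" "length xs \<le> 3"
  obtains u w where "path2 i u z w" "{u, z, w} \<inter> set xs = {}"
proof -
  obtain u where u: "u \<in> nb V i z" "u \<notin> set xs"
    using ex_notin_list[of xs "nb V i z"] assms by auto
  obtain w where w: "w \<in> nb V i z" "w \<notin> set (u # xs)"
    using ex_notin_list[of "u # xs" "nb V i z"] assms by auto
  have "path2 i u z w" "{u, z, w} \<inter> set xs = {}"
    using u w assms by (auto simp: path2_def nb_iff)
  then show ?thesis using that by blast
qed

abbreviation balanced_path :: bool where
  "balanced_path \<equiv> has_path6 V c {#a, a, b, b, g, g#}"

text \<open>Off \<open>z\<close> both colors are matchings, so an edge leaving an
  \<open>a\<close>-edge is green unless it is a \<open>b\<close>-edge, and each vertex has at most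
  one such \<open>b\<close>-edge. Offering two candidates at each link therefore always yields a
  green one.\<close>

lemma balanced_path_of_matching_and_star:
  assumes z: "z \<in> V"
    and fa: "\<nexists>u v w. path2 a u v w \<and> z \<notin> {u, v, w}"
    and fb: "\<nexists>u v w. path2 b u v w \<and> z \<notin> {u, v, w}"
    and star: "card (nb V b z) \<ge> 10"
    and big: "card (color_edges a) \<ge> card (nb V a z) + 10"
  shows balanced_path
proof -
  define M where "M = {e \<in> color_edges a. z \<notin> e}"
  have "color_edges a - M \<subseteq> (\<lambda>u. {z, u}) ` nb V a z"
  proof
    fix e assume e: "e \<in> color_edges a - M"
    then have "z \<in> e" by (auto simp: M_def)
    then obtain u where "e = {z, u}" "u \<noteq> z"
      using e by (auto simp: color_edges_def card_2_iff)
    then show "e \<in> (\<lambda>u. {z, u}) ` nb V a z" using e by (auto simp: color_edges_def nb_def)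
  qed
  then have "card (color_edges a - M) \<le> card (nb V a z)"
    using finite_nb by (meson card_image_le card_mono finite_imageI order_trans subset_refl)
  moreover have "card (color_edges a) = card M + card (color_edges a - M)"
    using finite_color_edges[of a] card_Diff_subset[of M "color_edges a"]
      card_mono[of "color_edges a" M] finite_subset[of M "color_edges a"] by (auto simp: M_def)
  ultimately have M10: "card M \<ge> 10" using big by linarith
  have fa': "\<nexists>u v w. path2 a u v w \<and> {u, v, w} \<inter> {z} = {}" using fa by blast
  have notg: "c {v, w} = g"
    if "c {u, v} = a" "{u, v, w} \<subseteq> V - {z}" "distinct [u, v, w]" "c {v, w} \<noteq> b" for u v w
    using fa that color_cases[of v w] by (auto simp: path2_def)
  have notbb: "c {v, u} \<noteq> b \<or> c {v, w} \<noteq> b"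
    if "{u, v, w} \<subseteq> V - {z}" "distinct [u, v, w]" for u v w
    using fb that by (auto simp: path2_def insert_commute)
  have edge: "\<exists>x y. e = {x, y} \<and> x \<noteq> y \<and> x \<in> V - {z} \<and> y \<in> V - {z} \<and> c {x, y} = a" if "e \<in> M" for e
    using that by (auto simp: M_def color_edges_def card_2_iff)
  have disj: "e \<inter> e' = {}" if "e \<in> M" "e' \<in> M" "e \<noteq> e'" for e e'
    using color_edges_disjoint[OF fa', of e e'] that by (simp add: M_def)
  obtain e1 where e1: "e1 \<in> M" using M10 by (metis card.empty ex_in_conv not_numeral_le_zero)
  obtain e2 where e2: "e2 \<in> M" "e2 \<notin> set [e1]"
    using ex_notin_list[of "[e1]" M] M10 by auto
  obtain e3 where e3: "e3 \<in> M" "e3 \<notin> set [e1, e2]"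
    using ex_notin_list[of "[e1, e2]" M] M10 by auto
  obtain x y where xy: "e1 = {x, y}" "x \<noteq> y" "x \<in> V - {z}" "y \<in> V - {z}" "c {x, y} = a"
    using edge[OF e1] by blast
  \<comment> \<open>Of the edges from \<open>y\<close> to an end of \<open>e2\<close> and to an end
    of \<open>e3\<close>, at most one has color \<open>b\<close>.\<close>
  have "\<exists>p q. {p, q} \<in> M \<and> p \<noteq> q \<and> p \<in> V - {z} \<and> q \<in> V - {z} \<and> c {p, q} = a \<and> {p, q} \<inter> {x, y} = {} \<and> c {y, p} = g"
  proof -
    obtain p q where pq: "e2 = {p, q}" "p \<noteq> q" "p \<in> V - {z}" "q \<in> V - {z}" "c {p, q} = a"
      using edge[OF e2(1)] by blast
    obtain p' q' where pq': "e3 = {p', q'}" "p' \<noteq> q'" "p' \<in> V - {z}" "q' \<in> V - {z}" "c {p', q'} = a"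
      using edge[OF e3(1)] by blast
    have d: "e2 \<inter> e1 = {}" "e3 \<inter> e1 = {}" "e3 \<inter> e2 = {}"
      using disj e1 e2 e3 by auto
    have "c {y, p} \<noteq> b \<or> c {y, p'} \<noteq> b"
      using notbb[of p y p'] d pq pq' xy by auto
    then show ?thesis
    proof
      assume "c {y, p} \<noteq> b"
      then have "c {y, p} = g" using notg[of x y p] d pq xy by auto
      then show ?thesis using pq d xy e2 by blast
    next
      assume "c {y, p'} \<noteq> b"
      then have "c {y, p'} = g" using notg[of x y p'] d pq' xy by auto
      then show ?thesis using pq' d xy e3 by blast
    qed
  qed
  then obtain p q where pq: "p \<noteq> q" "p \<in> V - {z}" "q \<in> V - {z}" "c {p, q} = a"
    "{p, q} \<inter> {x, y} = {}" "c {y, p} = g" by blast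
  obtain u1 where u1: "u1 \<in> nb V b z" "u1 \<notin> set [x, y, p, q]"
    using ex_notin_list[of "[x, y, p, q]" "nb V b z"] star by auto
  obtain u2 where u2: "u2 \<in> nb V b z" "u2 \<notin> set [x, y, p, q, u1]"
    using ex_notin_list[of "[x, y, p, q, u1]" "nb V b z"] star by auto
  have "c {q, u1} \<noteq> b \<or> c {q, u2} \<noteq> b"
    using notbb[of u1 q u2] u1 u2 pq by (auto simp: nb_iff)
  then obtain u where u: "u \<in> nb V b z" "u \<notin> set [x, y, p, q]" "c {q, u} \<noteq> b"
    using u1 u2 by auto
  then have qu: "c {q, u} = g" using notg[of p q u] pq by (auto simp: nb_iff)
  obtain w where w: "w \<in> nb V b z" "w \<notin> set [x, y, p, q, u]"
    using ex_notin_list[of "[x, y, p, q, u]" "nb V b z"] star by auto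
  \<comment> \<open>The colors along the path are a, g, a, g, b, b.\<close>
  show ?thesis
    by (rule has_path6I[of x y p q u z w]) (use xy pq u qu w z in \<open>auto simp: nb_iff\<close>)
qed

end

section \<open>Linking through a large monochromatic clique\<close>

locale three_colored_clique = three_colored +
  fixes K :: "'a set"
  assumes K_subset: "K \<subseteq> V"
    and K_clique: "\<lbrakk>x \<in> K; y \<in> K; x \<noteq> y\<rbrakk> \<Longrightarrow> c {x, y} = g"
    and card_K: "card K \<ge> 60"
begin

lemma swapped_clique: "three_colored_clique V c b a g K"
  using swapped K_subset K_clique card_K
  by (simp add: three_colored_clique_def three_colored_clique_axioms_def)

lemma nb_notin_list:
  assumes "length xs < card (nb K i v)"
  obtains k where "k \<in> K" "k \<in> V" "k \<noteq> v" "c {v, k} = i" "c {k, v} = i" "k \<notin> set xs"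
  using ex_notin_list[OF assms] K_subset nb_iff by (metis subsetD)

lemma K_notin_list:
  assumes "length xs < 60"
  obtains k where "k \<in> K" "k \<in> V" "k \<notin> set xs"
  using ex_notin_list[of xs K] assms card_K K_subset by (metis order_less_le_trans subsetD)

text \<open>At most 18 of the at least 59 vertices of \<open>K\<close> other than \<open>v\<close>
  are joined to it in color \<open>a\<close> or \<open>b\<close>.\<close>

lemma card_nb_green:
  assumes "v \<in> V" "card (nb K a v) < 10" "card (nb K b v) < 10"
  shows "card (nb K g v) \<ge> 10"
proof -
  have "card (K - {v}) \<ge> 59"
    using card_K diff_card_le_card_Diff[of "{v}" K] by simp
  then show ?thesis using card_nb_add[OF K_subset assms(1)] assms by linarith
qed

text \<open>Two cherries centered at \<open>r\<close> and \<open>s\<close> with leaves in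
  \<open>K\<close> are joined by a clique edge, and a second clique edge is appended: a, a, g, b, b,
  g.\<close>

lemma balanced_path_of_two_attached:
  assumes "r \<in> V" "s \<in> V" "r \<noteq> s" "card (nb K a r) \<ge> 10" "card (nb K b s) \<ge> 10"
  shows balanced_path
proof -
  obtain k1 where k1: "k1 \<in> K" "k1 \<in> V" "k1 \<noteq> r" "c {r, k1} = a" "c {k1, r} = a" "k1 \<notin> set [s]"
    using nb_notin_list[of "[s]" a r] assms by auto
  obtain k2 where k2: "k2 \<in> K" "k2 \<in> V" "k2 \<noteq> r" "c {r, k2} = a" "c {k2, r} = a" "k2 \<notin> set [s, k1]"
    using nb_notin_list[of "[s, k1]" a r] assms by auto
  obtain k3 where k3: "k3 \<in> K" "k3 \<in> V" "k3 \<noteq> s" "c {s, k3} = b" "c {k3, s} = b" "k3 \<notin> set [r, k1, k2]"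
    using nb_notin_list[of "[r, k1, k2]" b s] assms by auto
  obtain k4 where k4: "k4 \<in> K" "k4 \<in> V" "k4 \<noteq> s" "c {s, k4} = b" "c {k4, s} = b" "k4 \<notin> set [r, k1, k2, k3]"
    using nb_notin_list[of "[r, k1, k2, k3]" b s] assms by auto
  obtain k5 where k5: "k5 \<in> K" "k5 \<in> V" "k5 \<notin> set [r, s, k1, k2, k3, k4]"
    using K_notin_list[of "[r, s, k1, k2, k3, k4]"] by auto
  show ?thesis
    by (rule has_path6I[of k1 r k2 k3 s k4 k5])
      (use assms k1 k2 k3 k4 k5 K_clique[of k2 k3] K_clique[of k4 k5] in auto)
qed

text \<open>From \<open>w\<close> a green edge enters \<open>K\<close>, a clique edge moves on, and
  a cherry at \<open>r\<close> ends the path: b, b, g, g, a, a.\<close>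

lemma balanced_path_of_attached_and_green_end:
  assumes "r \<in> V" "card (nb K a r) \<ge> 10" "path2 b u v w" "r \<notin> {u, v, w}" "card (nb K g w) \<ge> 10"
  shows balanced_path
proof -
  obtain k1 where k1: "k1 \<in> K" "k1 \<in> V" "k1 \<noteq> w" "c {w, k1} = g" "c {k1, w} = g" "k1 \<notin> set [u, v, r]"
    using nb_notin_list[of "[u, v, r]" g w] assms by auto
  obtain k2 where k2: "k2 \<in> K" "k2 \<in> V" "k2 \<noteq> r" "c {r, k2} = a" "c {k2, r} = a" "k2 \<notin> set [u, v, w, k1]"
    using nb_notin_list[of "[u, v, w, k1]" a r] assms by auto
  obtain k3 where k3: "k3 \<in> K" "k3 \<in> V" "k3 \<noteq> r" "c {r, k3} = a" "c {k3, r} = a" "k3 \<notin> set [u, v, w, k1, k2]"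
    using nb_notin_list[of "[u, v, w, k1, k2]" a r] assms by auto
  show ?thesis
    by (rule has_path6I[of u v w k1 k2 r k3])
      (use assms k1 k2 k3 K_clique[of k1 k2] in \<open>auto simp: path2_def\<close>)
qed

text \<open>Here both \<open>a\<close>-edges come from the ends of the \<open>b\<close>-path and
  both green edges lie inside \<open>K\<close>: a, b, b, a, g, g.\<close>

lemma balanced_path_of_attached_ends:
  assumes "path2 b u v w" "card (nb K a u) \<ge> 10" "card (nb K a w) \<ge> 10"
  shows balanced_path
proof -
  obtain k1 where k1: "k1 \<in> K" "k1 \<in> V" "k1 \<noteq> u" "c {u, k1} = a" "c {k1, u} = a" "k1 \<notin> set [v, w]"
    using nb_notin_list[of "[v, w]" a u] assms by auto
  obtain k2 where k2: "k2 \<in> K" "k2 \<in> V" "k2 \<noteq> w" "c {w, k2} = a" "c {k2, w} = a" "k2 \<notin> set [u, v, k1]"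
    using nb_notin_list[of "[u, v, k1]" a w] assms by auto
  obtain k3 where k3: "k3 \<in> K" "k3 \<in> V" "k3 \<notin> set [u, v, w, k1, k2]"
    using K_notin_list[of "[u, v, w, k1, k2]"] by auto
  obtain k4 where k4: "k4 \<in> K" "k4 \<in> V" "k4 \<notin> set [u, v, w, k1, k2, k3]"
    using K_notin_list[of "[u, v, w, k1, k2, k3]"] by auto
  show ?thesis
    by (rule has_path6I[of k1 u v w k2 k3 k4])
      (use assms k1 k2 k3 k4 K_clique[of k2 k3] K_clique[of k3 k4] in \<open>auto simp: path2_def\<close>)
qed

text \<open>A \<open>b\<close>-path avoiding one of \<open>r\<close>, \<open>s\<close> can be
  completed. If none avoids \<open>r\<close>, the edge count forces a large \<open>b\<close>-star at
  \<open>r\<close>, and two of its edges avoid \<open>s\<close>.\<close>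

lemma balanced_path_of_attached_pair:
  assumes small: "\<And>v. v \<in> V \<Longrightarrow> card (nb K b v) < 10"
    and r: "r \<in> V" "card (nb K a r) \<ge> 10" and s: "s \<in> V" "card (nb K a s) \<ge> 10" and "r \<noteq> s"
    and big: "2 * card (color_edges b) > card V + 120"
  shows balanced_path
proof -
  have avoid: balanced_path
    if t: "t \<in> V" "card (nb K a t) \<ge> 10" and p: "path2 b u v w" "t \<notin> {u, v, w}" for t u v w
  proof -
    have V: "u \<in> V" "w \<in> V" using p by (auto simp: path2_def)
    \<comment> \<open>An end with few \<open>a\<close>-neighbors in \<open>K\<close> also has few
      \<open>b\<close>-neighbors there, hence many green ones.\<close>
    consider "card (nb K a u) \<ge> 10 \<and> card (nb K a w) \<ge> 10"
      | "card (nb K g u) \<ge> 10" | "card (nb K g w) \<ge> 10"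
      using card_nb_green small V by (meson not_less)
    then show ?thesis
    proof cases
      case 1 then show ?thesis using balanced_path_of_attached_ends p by blast
    next
      case 2
      then show ?thesis
        using balanced_path_of_attached_and_green_end[OF t, of w v u] p path2_commute by auto
    next
      case 3 then show ?thesis using balanced_path_of_attached_and_green_end[OF t p] by blast
    qed
  qed
  show ?thesis
  proof (rule ccontr)
    assume no: "\<not> ?thesis"
    then have "2 * card (color_edges b) \<le> card V + 2 * (\<Sum>s\<in>{r}. card (nb V b s))"
      by (intro card_color_edges_le) (use avoid r in auto)
    then have deg: "card (nb V b r) \<ge> 10" using big by simp
    obtain u where u: "u \<in> nb V b r" "u \<notin> set [s]"
      using ex_notin_list[of "[s]" "nb V b r"] deg by auto
    obtain w where w: "w \<in> nb V b r" "w \<notin> set [s, u]"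
      using ex_notin_list[of "[s, u]" "nb V b r"] deg by auto
    have "path2 b u r w" using u w r by (auto simp: path2_def nb_iff)
    then show False using avoid[OF s] no u w \<open>r \<noteq> s\<close> by auto
  qed
qed

text \<open>Disjoint 2-edge paths in \<open>a\<close> and \<open>b\<close> can be linked, so if
  there is no balanced path, every such pair must intersect. This concentrates both colors at one
  vertex \<open>t\<close>, where the matching-and-star argument applies.\<close>

lemma balanced_path_of_one_exception:
  assumes small: "\<And>v. v \<in> V - {r} \<Longrightarrow> card (nb K a v) < 10 \<and> card (nb K b v) < 10"
    and biga: "2 * card (color_edges a) > card V + 120" and bigb: "2 * card (color_edges b) > card V + 120"
  shows balanced_path
proof (rule ccontr)
  assume no: "\<not> ?thesis"
  have disj1: False
    if p: "path2 a x y z" "path2 b u v w" "{x, y, z} \<inter> {u, v, w} = {}" "z \<noteq> r" "u \<noteq> r" for x y z u v w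
  proof -
    have "z \<in> V" "u \<in> V" using p by (auto simp: path2_def)
    have "card (nb K g z \<inter> nb K g u) \<ge> 10"
    proof -
      have fK: "finite K" using K_subset finite_V finite_subset by blast
      \<comment> \<open>The 19 counts \<open>t\<close> itself and at most nine neighbors in each of
        \<open>a\<close> and \<open>b\<close>. Two such losses leave at least 22 of the 60 clique
        vertices.\<close>
      have *: "card (K - nb K g t) \<le> 19" if t: "t \<in> V" "t \<noteq> r" for t
      proof -
        have "K - nb K g t \<subseteq> {t} \<union> (nb K a t \<union> nb K b t)"
          using color_cases[of t] K_subset t by (auto simp: nb_def)
        then have "card (K - nb K g t) \<le> card ({t} \<union> (nb K a t \<union> nb K b t))"
          by (rule card_mono[rotated]) (use finite_nb[OF K_subset] in auto)
        also have "\<dots> \<le> 1 + (card (nb K a t) + card (nb K b t))"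
          by (rule order_trans[OF card_Un_le]) (simp add: card_Un_le)
        finally show ?thesis using small[of t] t by auto
      qed
      have "K = (nb K g z \<inter> nb K g u) \<union> ((K - nb K g z) \<union> (K - nb K g u))"
        by (auto simp: nb_def)
      then have "card K \<le> card (nb K g z \<inter> nb K g u) + (card (K - nb K g z) + card (K - nb K g u))"
        by (metis card_Un_le add_left_mono order_trans)
      then show ?thesis using *[of z] *[of u] \<open>z \<in> V\<close> \<open>u \<in> V\<close> p(4,5) card_K by linarith
    qed
    then obtain k where k: "k \<in> nb K g z \<inter> nb K g u" "k \<notin> set [x, y, v, w]"
      using ex_notin_list[of "[x, y, v, w]" "nb K g z \<inter> nb K g u"] by auto
    have balanced_path
      by (rule has_path6I[of x y z k u v w])
        (use p k K_subset in \<open>auto simp: path2_def nb_iff\<close>)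
    then show False using no by blast
  qed
  have disj: False
    if p: "path2 a x y z" "path2 b u v w" "{x, y, z} \<inter> {u, v, w} = {}" for x y z u v w
  proof -
    \<comment> \<open>Each path has an end other than \<open>r\<close>; reversing the paths puts
      these ends at the link.\<close>
    have "z \<noteq> x" "u \<noteq> w" using p by (auto simp: path2_def)
    then consider "z \<noteq> r \<and> u \<noteq> r" | "x \<noteq> r \<and> u \<noteq> r" | "z \<noteq> r \<and> w \<noteq> r" | "x \<noteq> r \<and> w \<noteq> r" by blast
    then show False
      using disj1[of x y z u v w] disj1[of z y x u v w] disj1[of x y z w v u] disj1[of z y x w v u] p
        path2_commute[of a x] path2_commute[of b u] by cases auto
  qed
  obtain x y z where xyz: "path2 a x y z"
    using card_color_edges_le[of "{}" a] biga by auto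
  have "{x, y, z} \<subseteq> V" "distinct [x, y, z]" using xyz unfolding path2_def by blast+
  have "\<nexists>u v w. path2 b u v w \<and> {u, v, w} \<inter> {x, y, z} = {}"
    using disj[OF xyz] by (metis Int_commute)
  then have "2 * card (color_edges b) \<le> card V + 2 * (\<Sum>s\<in>{x, y, z}. card (nb V b s))"
    by (rule card_color_edges_le[OF \<open>{x, y, z} \<subseteq> V\<close>])
  then have "card (nb V b x) + card (nb V b y) + card (nb V b z) > 60"
    using bigb \<open>distinct [x, y, z]\<close> by simp
  \<comment> \<open>Every \<open>b\<close>-path meets \<open>{x, y, z}\<close>, so one of these
    three vertices carries a large \<open>b\<close>-star.\<close>
  then have "card (nb V b x) \<ge> 10 \<or> card (nb V b y) \<ge> 10 \<or> card (nb V b z) \<ge> 10" by linarith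
  then obtain t where t: "t \<in> V" "card (nb V b t) \<ge> 10"
    using \<open>{x, y, z} \<subseteq> V\<close> by blast
  \<comment> \<open>An \<open>a\<close>-path avoiding \<open>t\<close> would be disjoint from some
    \<open>b\<close>-path centered at \<open>t\<close>.\<close>
  have fa: "\<nexists>u v w. path2 a u v w \<and> t \<notin> {u, v, w}"
  proof (intro notI, elim exE conjE)
    fix u v w assume p: "path2 a u v w" "t \<notin> {u, v, w}"
    obtain l m where "path2 b l t m" "{l, t, m} \<inter> set [u, v, w] = {}"
      by (rule disjoint_path2_of_star[OF t, of "[u, v, w]"]) (use p(2) in simp_all)
    then show False using disj[OF p(1), of l t m] by (simp add: Int_commute)
  qed
  then have "2 * card (color_edges a) \<le> card V + 2 * (\<Sum>s\<in>{t}. card (nb V a s))"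
    by (intro card_color_edges_le) (use t in simp_all)
  then have ta: "card (nb V a t) \<ge> 10" using biga by simp
  have fb: "\<nexists>u v w. path2 b u v w \<and> t \<notin> {u, v, w}"
  proof (intro notI, elim exE conjE)
    fix u v w assume p: "path2 b u v w" "t \<notin> {u, v, w}"
    obtain l m where "path2 a l t m" "{l, t, m} \<inter> set [u, v, w] = {}"
      by (rule disjoint_path2_of_star[OF t(1) ta, of "[u, v, w]"]) (use p(2) in simp_all)
    then show False using disj[OF _ p(1), of l t m] by simp
  qed
  have "card (nb V a t) + card (nb V b t) \<le> card V"
    using card_nb_add[OF subset_refl t(1)] card_Diff1_le[of V t] by linarith
  \<comment> \<open>The two degrees at \<open>t\<close> sum to at most \<open>card V\<close>,
    whereas the two colors have more than \<open>card V + 120\<close> edges in total.\<close>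
  then consider "card (color_edges a) \<ge> card (nb V a t) + 10" | "card (color_edges b) \<ge> card (nb V b t) + 10"
    using biga bigb by linarith
  then show False
  proof cases
    case 1
    then show False using balanced_path_of_matching_and_star[OF t(1) fa fb t(2)] no by blast
  next
    case 2
    have "has_path6 V c {#b, b, a, a, g, g#}"
      by (rule three_colored.balanced_path_of_matching_and_star[OF swapped t(1)])
        (use fa fb ta 2 in \<open>simp_all\<close>)
    moreover have "{#b, b, a, a, g, g#} = {#a, a, b, b, g, g#}" by simp
    ultimately show False using no by argo
  qed
qed

lemma balanced_path_exists:
  assumes biga: "2 * card (color_edges a) > card V + 120" and bigb: "2 * card (color_edges b) > card V + 120"
  shows balanced_path
proof -
  interpret sw: three_colored_clique V c b a g K by (rule swapped_clique)
  have M: "{#b, b, a, a, g, g#} = {#a, a, b, b, g, g#}" by simp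
  define A where "A = {v \<in> V. card (nb K a v) \<ge> 10}"
  define B where "B = {v \<in> V. card (nb K b v) \<ge> 10}"
  have small: "v \<in> V \<Longrightarrow> v \<notin> A \<Longrightarrow> card (nb K a v) < 10" "v \<in> V \<Longrightarrow> v \<notin> B \<Longrightarrow> card (nb K b v) < 10" for v
    by (simp_all add: A_def B_def)
  have large: "v \<in> A \<Longrightarrow> v \<in> V \<and> card (nb K a v) \<ge> 10" "v \<in> B \<Longrightarrow> v \<in> V \<and> card (nb K b v) \<ge> 10" for v
    by (simp_all add: A_def B_def)
  \<comment> \<open>If \<open>A\<close> contains two vertices and \<open>B\<close> is nonempty, a
    vertex of \<open>B\<close> differs from one of the two, which gives case \<open>both\<close>;
    likewise with \<open>A\<close> and \<open>B\<close> exchanged.\<close>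
  consider (one) r where "A \<union> B \<subseteq> {r}" | (both) r s where "r \<in> A" "s \<in> B" "r \<noteq> s"
    | (onlyA) r s where "B = {}" "r \<in> A" "s \<in> A" "r \<noteq> s"
    | (onlyB) r s where "A = {}" "r \<in> B" "s \<in> B" "r \<noteq> s"
  proof (cases "\<exists>r. A \<union> B \<subseteq> {r}")
    case True then show ?thesis using one by blast
  next
    case False
    then obtain r s where rs: "r \<in> A \<union> B" "s \<in> A \<union> B" "r \<noteq> s" by blast
    then show ?thesis using both[of r s] both[of s r] onlyA[of r s] onlyB[of r s]
      by (metis Un_iff both ex_in_conv)
  qed
  then show ?thesis
  proof cases
    case one
    then show ?thesis
      using balanced_path_of_one_exception[OF _ biga bigb, of r] small by blast
  next
    case both
    then show ?thesis using balanced_path_of_two_attached large by blast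
  next
    case onlyA
    then show ?thesis
      using balanced_path_of_attached_pair[of r s] bigb small large by blast
  next
    case onlyB
    then show ?thesis
      using sw.balanced_path_of_attached_pair[of r s, unfolded M] biga small large by blast
  qed
qed

end

section \<open>From vertex sequences to balanced copies\<close>

lemma card_filter_eq_count:
  assumes "distinct xs"
  shows "card {x \<in> set xs. f x = i} = count (mset (map f xs)) i"
proof -
  have "count (mset (map f xs)) i = length (filter (\<lambda>x. f x = i) xs)"
    by (induction xs) auto
  then show ?thesis
    using distinct_length_filter[OF assms, of "\<lambda>x. f x = i"]
    by (simp add: Collect_conj_eq Int_commute)
qed

lemma path_graph_6: "path_graph 6 = ({..6}, set [{0, 1}, {1, 2}, {2, 3}, {3, 4}, {4, 5}, {5, 6}])"
proof -
  have "{{i, Suc i} | i. i < 6} = (\<lambda>i. {i, Suc i}) ` {..<6}" by blast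
  also have "{..<6::nat} = {0, 1, 2, 3, 4, 5}" by auto
  finally show ?thesis by (simp add: path_graph_def eval_nat_numeral)
qed

lemma contains_balanced_path6:
  assumes "has_path6 {..<n} c {#0, 0, 1, 1, 2, 2#}"
  shows "contains_balanced_copy 3 (complete_graph n) c (path_graph 6)"
proof -
  obtain p q r s t u v where d: "distinct [p, q, r, s, t, u, v]" and n: "{p, q, r, s, t, u, v} \<subseteq> {..<n}"
    and M: "{#c {p, q}, c {q, r}, c {r, s}, c {s, t}, c {t, u}, c {u, v}#} = {#0, 0, 1, 1, 2, 2#}"
    using assms unfolding has_path6_def by (elim exE conjE) (rule that)
  define xs where "xs = [p, q, r, s, t, u, v]"
  define es where "es = [{p, q}, {q, r}, {r, s}, {s, t}, {t, u}, {u, v}]"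
  \<comment> \<open>Distinctness of the edges turns multiplicities of colors into sizes of color
    classes.\<close>
  have es: "distinct es" using d by (simp add: es_def doubleton_eq_iff)
  define H where "H = (set xs, set es)"
  have "subgraph H (complete_graph n)"
    unfolding subgraph_def simple_graph_def complete_graph_def H_def
    using d n by (simp add: xs_def es_def)
  moreover have "graph_isomorphic (path_graph 6) H"
    unfolding graph_isomorphic_def
  proof (intro exI conjI)
    show "bij_betw ((!) xs) (verts (path_graph 6)) (verts H)"
      unfolding path_graph_6 H_def fst_conv
      by (rule bij_betw_nth) (use d in \<open>auto simp: xs_def\<close>)
    show "edges H = (\<lambda>e. (!) xs ` e) ` edges (path_graph 6)"
      by (simp add: path_graph_6 H_def xs_def es_def)
  qed
  moreover have "balanced 3 H c"
  proof -
    have "card (color_class H c i) = 2" if "i < 3" for i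
    proof -
      have "card (color_class H c i) = count {#0, 0, 1, 1, 2, 2#} i"
        unfolding color_class_def H_def snd_conv card_filter_eq_count[OF es] M[symmetric]
        by (simp add: es_def)
      moreover have "i = 0 \<or> i = 1 \<or> i = 2" using that by auto
      ultimately show ?thesis by auto
    qed
    moreover have "card (edges H) = 6"
      using distinct_card[OF es] by (simp add: H_def es_def)
    ultimately show ?thesis by (simp add: balanced_def)
  qed
  ultimately show ?thesis unfolding contains_balanced_copy_def by blast
qed

text \<open>Ramsey's theorem supplies a clique of 60 vertices in some color \<open>i\<close>, which
  takes the role of \<open>g\<close>; the other two colors become \<open>a\<close> and
  \<open>b\<close>.\<close>

lemma balanced_copy_of_large_classes:
  assumes N: "partn_lst {..<N} [60, 60, 60] 2" and "n \<ge> N"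
    and col: "edge_coloring 3 (complete_graph n) c"
    and big: "\<And>i. i < 3 \<Longrightarrow> 2 * card (color_class (complete_graph n) c i) > n + 120"
  shows "contains_balanced_copy 3 (complete_graph n) c (path_graph 6)"
proof -
  have "partn_lst {..<n} [60, 60, 60] 2"
    using partn_lst_greater_resource[OF N \<open>n \<ge> N\<close>] .
  moreover have c3: "c \<in> nsets {..<n} 2 \<rightarrow> {..<3}"
    using col by (auto simp: edge_coloring_def complete_graph_def nsets_def)
  ultimately obtain i K where "i < length [60, 60, 60::nat]" "K \<in> nsets {..<n} ([60, 60, 60] ! i)"
    and Ki: "c ` nsets K 2 \<subseteq> {i}"
    by (rule partn_lstE) simp
  then have i: "i = 0 \<or> i = 1 \<or> i = 2" and K: "K \<subseteq> {..<n}" "card K = 60"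
    by (auto simp: nsets_def less_Suc_eq)
  have clique: "c {x, y} = i" if "x \<in> K" "y \<in> K" "x \<noteq> y" for x y
    using Ki that by (auto simp: nsets_def image_subset_iff)
  have path: "has_path6 {..<n} c {#0, 0, 1, 1, 2, 2#}"
    if abi: "distinct [a, b, i]" "{a, b, i} = {0, 1, 2}"
      "{#a, a, b, b, i, i#} = {#0, 0, 1, 1, 2, 2#}" for a b
  proof -
    have lt3: "c {x, y} < 3" if "x < n" "y < n" "x \<noteq> y" for x y
      using col that by (auto simp: edge_coloring_def complete_graph_def)
    have cov: "j = a \<or> j = b \<or> j = i" if "j < 3" for j
    proof -
      have "j \<in> {0, 1, 2}" using that by auto
      then show ?thesis using abi(2) by blast
    qed
    interpret three_colored_clique "{..<n}" c a b i K
      by unfold_locales (use abi(1) lt3 cov K clique in \<open>simp_all\<close>)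
    have "color_edges j = color_class (complete_graph n) c j" for j
      by (auto simp: color_edges_def color_class_def complete_graph_def)
    moreover have "a \<in> {0, 1, 2}" "b \<in> {0, 1, 2}" using abi(2) by blast+
    then have "a < 3" "b < 3" by auto
    ultimately have balanced_path
      by (intro balanced_path_exists) (simp_all add: big)
    then show ?thesis unfolding abi(3) .
  qed
  from i have "has_path6 {..<n} c {#0, 0, 1, 1, 2, 2#}"
  proof (elim disjE)
    assume "i = 0"
    show ?thesis by (rule path[of 1 2]) (auto simp: \<open>i = 0\<close>)
  next
    assume "i = 1"
    show ?thesis by (rule path[of 0 2]) (auto simp: \<open>i = 1\<close>)
  next
    assume "i = 2"
    show ?thesis by (rule path[of 0 1]) (auto simp: \<open>i = 2\<close>)
  qed
  then show ?thesis by (rule contains_balanced_path6)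
qed

section \<open>The extremal coloring for the lower bound\<close>

definition split_star :: "nat \<Rightarrow> nat set \<Rightarrow> nat" where
  "split_star n e = (if 0 \<notin> e then 2 else if e \<subseteq> {..n div 2} then 0 else 1)"

text \<open>Color 1 on the edges from 0 to vertices above \<open>n div 2\<close> attains this bound
  for even \<open>n\<close>. For color 2 the edges from vertex 1 to later vertices suffice.\<close>

lemma card_split_star_class:
  assumes "n \<ge> 2" "i < 3"
  shows "card (color_class (complete_graph n) (split_star n) i) \<ge> n div 2 - 1"
proof -
  let ?C = "color_class (complete_graph n) (split_star n) i"
  have fin: "finite ?C" by (simp add: color_class_def complete_graph_def)
  have inj: "inj_on (\<lambda>j. {k, j}) J" for k :: nat and J
    by (auto simp: inj_on_def doubleton_eq_iff)
  have le: "card J \<le> card ?C" if "(\<lambda>j. {k, j}) ` J \<subseteq> ?C" for J k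
    using card_mono[OF fin that] card_image[OF inj] by metis
  consider "i = 0" | "i = 1" | "i = 2" using \<open>i < 3\<close> by linarith
  then show ?thesis
  proof cases
    case 1
    have "card {1..n div 2} \<le> card ?C"
      by (rule le[of 0]) (use 1 \<open>n \<ge> 2\<close> in \<open>auto simp: color_class_def complete_graph_def split_star_def\<close>)
    then show ?thesis by simp
  next
    case 2
    have "card {n div 2<..<n} \<le> card ?C"
      by (rule le[of 0]) (use 2 in \<open>auto simp: color_class_def complete_graph_def split_star_def\<close>)
    then show ?thesis by simp
  next
    case 3
    have "card {2..<n} \<le> card ?C"
      by (rule le[of 1]) (use 3 in \<open>auto simp: color_class_def complete_graph_def split_star_def\<close>)
    then show ?thesis by simp
  qed
qed

text \<open>Colors 0 and 1 occur only on edges at vertex 0. A path has at most two of these, while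
  balance demands four.\<close>

lemma split_star_no_balanced_path6:
  "\<not> contains_balanced_copy 3 (complete_graph n) (split_star n) (path_graph 6)"
proof
  assume "contains_balanced_copy 3 (complete_graph n) (split_star n) (path_graph 6)"
  then obtain H f where bal: "balanced 3 H (split_star n)"
    and f: "bij_betw f {..6} (verts H)" and E: "edges H = (\<lambda>e. f ` e) ` {{i, Suc i} | i. i < 6}"
    unfolding contains_balanced_copy_def graph_isomorphic_def by (auto simp: path_graph_def)
  have inj: "inj_on f {..6}" using f by (simp add: bij_betw_def)
  have E': "edges H = (\<lambda>i. f ` {i, Suc i}) ` {..<6}" unfolding E by (auto simp del: image_insert)
  have "inj_on (\<lambda>i. f ` {i, Suc i}) {..<6}"
  proof (rule inj_onI)
    fix i j :: nat assume ij: "i \<in> {..<6}" "j \<in> {..<6}" "f ` {i, Suc i} = f ` {j, Suc j}"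
    then have "{i, Suc i} = {j, Suc j}"
      using inj_on_image_eq_iff[OF inj, of "{i, Suc i}" "{j, Suc j}"] by auto
    then show "i = j" by (auto simp: doubleton_eq_iff)
  qed
  then have "card (edges H) = 6" unfolding E' by (simp add: card_image)
  then have two: "card (color_class H (split_star n) i) = 2" if "i < 3" for i
    using bal that by (auto simp: balanced_def)
  let ?S = "{e \<in> edges H. 0 \<in> e}"
  have fE: "finite (edges H)" unfolding E' by simp
  have "color_class H (split_star n) 0 \<union> color_class H (split_star n) 1 \<subseteq> ?S"
    by (auto simp: color_class_def split_star_def split: if_splits)
  then have "card (color_class H (split_star n) 0 \<union> color_class H (split_star n) 1) \<le> card ?S"
    using fE by (intro card_mono) auto
  moreover have "card (color_class H (split_star n) 0 \<union> color_class H (split_star n) 1) = 2 + 2"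
    using two[of 0] two[of 1] fE by (subst card_Un_disjoint) (auto simp: color_class_def)
  moreover have "card ?S \<le> 2"
  proof -
    have "\<exists>A. ?S \<subseteq> (\<lambda>i. f ` {i, Suc i}) ` A \<and> finite A \<and> card A \<le> 2"
    proof (cases "\<exists>k\<le>6. f k = 0")
      case True
      then obtain k where k: "k \<le> 6" "f k = 0" by blast
      have k': "j = k" if "j \<le> 6" "f j = 0" for j
        using inj that k by (auto simp: inj_on_def)
      \<comment> \<open>At \<open>k = 0\<close> truncated subtraction merges the two indices; at
        \<open>k = 6\<close> the index 6 is no edge of the path and only enlarges the image.\<close>
      have "?S \<subseteq> (\<lambda>i. f ` {i, Suc i}) ` {k - 1, k}"
      proof
        fix e assume "e \<in> ?S"
        then obtain i where i: "i < 6" "e = f ` {i, Suc i}" "0 \<in> e" unfolding E' by auto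
        then have "i = k \<or> Suc i = k" using k'[of i] k'[of "Suc i"] by auto
        then show "e \<in> (\<lambda>i. f ` {i, Suc i}) ` {k - 1, k}" using i(2) by auto
      qed
      moreover have "card {k - 1, k} \<le> 2" by (simp add: card_insert_if)
      ultimately show ?thesis by blast
    next
      case False
      have "?S = {}"
      proof (rule ccontr)
        assume "?S \<noteq> {}"
        then obtain i where i: "i < 6" "0 \<in> f ` {i, Suc i}" unfolding E' by auto
        then have "f i = 0 \<or> f (Suc i) = 0" by auto
        then show False using False i(1) by (meson Suc_leI less_imp_le_nat)
      qed
      then show ?thesis by (intro exI[of _ "{}"]) simp
    qed
    then obtain A where A: "?S \<subseteq> (\<lambda>i. f ` {i, Suc i}) ` A" "finite A" "card A \<le> 2"
      by (elim exE conjE) (rule that)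
    show ?thesis using surj_card_le[OF A(2,1)] A(3) by (rule le_trans)
  qed
  ultimately show False by simp
qed

section \<open>Bounds on \<open>bal\<close> and the limit\<close>

lemma bal_path6_upper:
  assumes "partn_lst {..<N} [60, 60, 60] 2" "n \<ge> N"
  shows "bal 3 n (path_graph 6) \<le> enat (n div 2 + 60)"
  unfolding bal_def
proof (rule Inf_lower, intro CollectI exI conjI, rule refl, intro allI impI)
  fix c assume c: "edge_coloring 3 (complete_graph n) c \<and>
    (\<forall>i<3. n div 2 + 60 < card (color_class (complete_graph n) c i))"
  show "contains_balanced_copy 3 (complete_graph n) c (path_graph 6)"
  proof (rule balanced_copy_of_large_classes[OF assms])
    fix i :: nat assume "i < 3"
    then have "n div 2 + 60 < card (color_class (complete_graph n) c i)" using c by blast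
    \<comment> \<open>The strict inequality absorbs the rounding in \<open>n div 2\<close>.\<close>
    then show "2 * card (color_class (complete_graph n) c i) > n + 120" by linarith
  qed (use c in blast)
qed

lemma bal_path6_lower:
  assumes "n \<ge> 2"
  shows "enat (n div 2 - 1) \<le> bal 3 n (path_graph 6)"
  unfolding bal_def
proof (rule Inf_greatest, elim CollectE exE conjE)
  fix x m assume x: "x = enat m" and m: "\<forall>c. edge_coloring 3 (complete_graph n) c \<and>
      (\<forall>i<3. m < card (color_class (complete_graph n) c i)) \<longrightarrow>
      contains_balanced_copy 3 (complete_graph n) c (path_graph 6)"
  have "edge_coloring 3 (complete_graph n) (split_star n)"
    by (simp add: edge_coloring_def split_star_def)
  then have "\<not> (\<forall>i<3. m < card (color_class (complete_graph n) (split_star n) i))"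
    using m split_star_no_balanced_path6 by blast
  then show "enat (n div 2 - 1) \<le> x"
    using card_split_star_class[OF assms] x by (meson enat_ord_simps(1) le_trans not_less)
qed

theorem theorem1p11:
  "\<exists>\<epsilon> :: nat \<Rightarrow> real. \<epsilon> \<longlonglongrightarrow> 0 \<and>
     (\<forall>\<^sub>F n in sequentially.
        ereal_of_enat (bal 3 n (path_graph 6)) = ereal ((1 / 2 + \<epsilon> n) * real n))"
proof -
  obtain N :: nat where N: "partn_lst {..<N} [60, 60, 60] 2"
    using ramsey_full by blast
  \<comment> \<open>For \<open>n \<ge> max N 2\<close> the upper bound makes \<open>bal\<close>
    finite, so \<open>the_enat\<close> returns its true value; smaller \<open>n\<close> do not
    affect the limit.\<close>
  define m where "m n = the_enat (bal 3 n (path_graph 6))" for n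
  define \<epsilon> where "\<epsilon> n = real (m n) / real n - 1 / 2" for n
  have m: "bal 3 n (path_graph 6) = enat (m n) \<and> n div 2 - 1 \<le> m n \<and> m n \<le> n div 2 + 60"
    if "n \<ge> max N 2" for n
  proof -
    have up: "bal 3 n (path_graph 6) \<le> enat (n div 2 + 60)" using bal_path6_upper[OF N] that by simp
    have lo: "enat (n div 2 - 1) \<le> bal 3 n (path_graph 6)" using bal_path6_lower that by simp
    obtain k where "bal 3 n (path_graph 6) = enat k" using up enat_ile by blast
    then show ?thesis using up lo by (simp add: m_def)
  qed
  have bound: "\<bar>\<epsilon> n\<bar> \<le> 61 / real n" if "n \<ge> max N 2" for n
  proof -
    \<comment> \<open>One symmetric slack covers the excess 120 above and the rounding loss below;
      half of it is the 61.\<close>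
    have "2 * m n \<le> n + 122" "n \<le> 2 * m n + 122" using m[OF that] by linarith+
    then have "2 * real (m n) \<le> real n + 122" "real n \<le> 2 * real (m n) + 122" by linarith+
    then have "\<bar>real (m n) - real n / 2\<bar> \<le> 61" by linarith
    moreover have "\<epsilon> n = (real (m n) - real n / 2) / real n"
      using that by (simp add: \<epsilon>_def field_simps)
    ultimately show ?thesis by (simp add: divide_right_mono)
  qed
  have "\<epsilon> \<longlonglongrightarrow> 0"
  proof (rule tendsto_0_le[where f = "\<lambda>n. 61 / real n" and K = 1])
    show "(\<lambda>n. 61 / real n) \<longlonglongrightarrow> 0" by (rule lim_const_over_n)
    show "\<forall>\<^sub>F n in sequentially. norm (\<epsilon> n) \<le> norm (61 / real n) * 1"
      using eventually_ge_at_top[of "max N 2"] by eventually_elim (use bound in simp)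
  qed
  moreover have "\<forall>\<^sub>F n in sequentially.
      ereal_of_enat (bal 3 n (path_graph 6)) = ereal ((1 / 2 + \<epsilon> n) * real n)"
    using eventually_ge_at_top[of "max N 2"]
  proof eventually_elim
    case (elim n)
    then show ?case using m[OF elim] by (simp add: \<epsilon>_def)
  qed
  ultimately show ?thesis by blast
qed

end
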